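(* Let $X_1,X_2,\ldots$ and $Y_1,Y_2,\ldots$ be two independent sequences of i.i.d. unit exponential random variables, and for each $n$ let $X_{(1)}\le\cdots\le X_{(n)}$ and $Y_{(1)}\le\cdots\le Y_{(n)}$ be the order statistics of $X_1,\ldots,X_n$ and $Y_1,\ldots,Y_n$ respectively. Let $\ell$ be a fixed positive integer. Then, as $n\to\infty$ ($n\ge\ell$), the random variable $\max_{1\le i\le \ell} X_{(i)}/Y_{(i)}$ converges weakly to a random variable with a non-degenerate distribution, whose distribution function is, for $t\ge 0$, $$\mathcal{R}_\ell(t)=\lim_{n\to\infty}P\Big(\max_{1\le i\le \ell}\frac{X_{(i)}}{Y_{(i)}}\le t\Big)=\frac{\sum_{j=0}^{\ell-1}(-1)^j B_{\ell-1,j}\,k^{\ell-j-1}}{k^{2\ell-1}},\qquad k=1+\frac1t,$$ where $$B_{\ell,j}=\frac{1}{\ell+1}\binom{2\ell+2}{\ell-j}\binom{\ell+j}{\ell}.$$ (At $t=0$ the right-hand side is understood as its limit $k\to\infty$, namely $0$.)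
   Context: A unit exponential random variable has distribution function $1-e^{-x}$, $x\ge 0$. In the sum, $B_{\ell-1,j}$ is obtained from the displayed definition of $B_{\ell,j}$ with $\ell$ replaced by $\ell-1$. *)

theory Defs
  imports "HOL-Probability.Probability"
begin

text \<open>
  Sequences start at index 0, so \<open>X j\<close> stands for the informal \<open>X\<^sub>j\<^sub>+\<^sub>1\<close> and
  \<open>X\<^sub>1, \<dots>, X\<^sub>n\<close> are \<open>X 0, \<dots>, X (n - 1)\<close>. Order statistics keep their usual
  index \<open>i \<in> {1..n}\<close>; outside this range the value is meaningless.
\<close>

definition order_stat :: "(nat \<Rightarrow> 'a \<Rightarrow> real) \<Rightarrow> nat \<Rightarrow> nat \<Rightarrow> 'a \<Rightarrow> real" where
  "order_stat X n i \<omega> = sort (map (\<lambda>j. X j \<omega>) [0..<n]) ! (i - 1)"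

definition max_ratio ::
  "(nat \<Rightarrow> 'a \<Rightarrow> real) \<Rightarrow> (nat \<Rightarrow> 'a \<Rightarrow> real) \<Rightarrow> nat \<Rightarrow> nat \<Rightarrow> 'a \<Rightarrow> real" where
  "max_ratio X Y l n \<omega> = (MAX i\<in>{1..l}. order_stat X n i \<omega> / order_stat Y n i \<omega>)"

definition unit_exponential :: "'a measure \<Rightarrow> ('a \<Rightarrow> real) \<Rightarrow> bool" where
  "unit_exponential M X \<longleftrightarrow> distributed M lborel X (exponential_density 1)"

definition iid_unit_exponential :: "'a measure \<Rightarrow> (nat \<Rightarrow> 'a \<Rightarrow> real) \<Rightarrow> bool" where
  "iid_unit_exponential M X \<longleftrightarrow>
     prob_space.indep_vars M (\<lambda>_. borel) X UNIV \<and> (\<forall>j. unit_exponential M (X j))"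

text \<open>
  Independence of two sequences as random elements of the product space of real
  sequences, that is, of the sigma-algebras generated by the whole sequences.
\<close>

definition indep_sequences ::
  "'a measure \<Rightarrow> (nat \<Rightarrow> 'a \<Rightarrow> real) \<Rightarrow> (nat \<Rightarrow> 'a \<Rightarrow> real) \<Rightarrow> bool" where
  "indep_sequences M X Y \<longleftrightarrow>
     prob_space.indep_var M (Pi\<^sub>M UNIV (\<lambda>_. borel)) (\<lambda>\<omega> j. X j \<omega>)
                            (Pi\<^sub>M UNIV (\<lambda>_. borel)) (\<lambda>\<omega> j. Y j \<omega>)"

definition nondegenerate :: "real measure \<Rightarrow> bool" where
  "nondegenerate \<mu> \<longleftrightarrow> \<not> (\<exists>c. AE x in \<mu>. x = c)"

definition B :: "nat \<Rightarrow> nat \<Rightarrow> real" where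
  "B l j = 1 / (real l + 1) * real ((2 * l + 2) choose (l - j)) * real ((l + j) choose l)"

text \<open>
  The value at \<open>t = 0\<close> is set by hand to the limit of the formula as \<open>k \<rightarrow> \<infinity>\<close>, because
  \<open>1 / 0 = 0\<close> in HOL. Only \<open>l \<ge> 1\<close> and \<open>t \<ge> 0\<close> matter; under \<open>l \<ge> 1\<close> none of the
  natural-number subtractions truncates.
\<close>

definition R :: "nat \<Rightarrow> real \<Rightarrow> real" where
  "R l t = (if t = 0 then 0
     else let k = 1 + 1 / t in
       (\<Sum>j = 0..l - 1. (-1) ^ j * B (l - 1) j * k ^ (l - j - 1)) / k ^ (2 * l - 1))"

end

theory Submission
  imports Defs "HOL-Real_Asymp.Real_Asymp"
begin

text \<open>
  Fix \<open>t > 0\<close>. The event \<open>max_ratio X Y l n \<le> t\<close> says that \<open>X\<^sub>(\<^sub>i\<^sub>) \<le> t Y\<^sub>(\<^sub>i\<^sub>)\<close> for all \<open>i \<le> l\<close>. Regard the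
  \<open>X\<^sub>j\<close> and the \<open>t Y\<^sub>j\<close> as the ringing times of \<open>2 n\<close> independent exponential clocks, of rate \<open>1\<close> and of rate
  \<open>q = 1 / t\<close> respectively. Then the event says that in the order of ringing the \<open>t Y\<close> side never
  gets ahead of the \<open>X\<close> side until the latter has \<open>l\<close> points (\<open>max_ratio_le_iff_leads\<close>).

  By memorylessness the order of ringing is a Markov chain: with \<open>x\<close> and \<open>y\<close> clocks of the two kinds left, the next
  point is an \<open>X\<close> point with probability \<open>x / (x + q y)\<close>. So the probability of the
  event satisfies the recursion that defines \<open>race\<close>. This is made rigorous
  without conditional distributions: \<open>first_point_decomposition\<close> splits a product of
  exponential laws according to the clock that rings first, and \<open>emeasure_race_leads\<close> carries the factor
  \<open>exp (- s * Q)\<close>, the probability that clocks of total rate \<open>Q\<close> all ring after \<open>s\<close>, through the induction.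

  For \<open>n \<rightarrow> \<infinity>\<close> the probability of an \<open>X\<close> step tends to the constant \<open>p = 1 / (1 + q) = t / (1 + t) = 1 / k\<close>, and
  the limit is the probability that a simple random walk with up probability \<open>p\<close> makes \<open>l\<close> up steps before it
  becomes negative (\<open>race_tendsto_ballot\<close>). Counting paths by the reflection principle, with \<open>l = L + 1\<close>, it
  equals \<open>p ^ l\<close> times the sum over \<open>m \<le> L\<close> of the ballot number
  \<open>(L + m choose L) - (L + m choose L + 1)\<close> times \<open>(1 - p) ^ m\<close>. Expanded in powers of \<open>p\<close>, this has the
  coefficients \<open>(-1) ^ j * B L j\<close> (\<open>sum_ballot_numbers_eq_B\<close>), which is the claimed formula.

  The limit, extended by \<open>0\<close> to \<open>t \<le> 0\<close>, is monotone, continuous, and tends to \<open>1\<close> at infinity, hence it is the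
  distribution function of a law without atoms; pointwise convergence everywhere is weak convergence to it.
\<close>

section \<open>The discrete race and its limit\<close>

text \<open>
The probability that the race is won, as a function of its state: \<open>x\<close> clocks of rate 1 and \<open>y\<close>
clocks of rate \<open>q\<close> are still running, the rate 1 side needs \<open>a\<close> more points to win, and \<open>h\<close> is one more
than its lead. The shift makes \<open>h = 0\<close> the state in which the other side has overtaken and the race
is lost. The next point belongs to the rate 1 side with probability \<open>x / (x + q y)\<close>.
\<close>

fun race :: "real \<Rightarrow> nat \<Rightarrow> nat \<Rightarrow> nat \<Rightarrow> nat \<Rightarrow> real" where
  "race q 0 h x y = 1"
| "race q (Suc a) 0 x y = 0"
| "race q (Suc a) (Suc h) x y =
     (real x * race q a (Suc (Suc h)) (x - 1) y + q * real y * race q (Suc a) h x (y - 1))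
       / (real x + q * real y)"

text \<open>
The same recursion for a walk whose steps go up with the constant probability \<open>p\<close>.
\<close>

fun ballot :: "real \<Rightarrow> nat \<Rightarrow> nat \<Rightarrow> real" where
  "ballot p 0 h = 1"
| "ballot p (Suc a) 0 = 0"
| "ballot p (Suc a) (Suc h) = p * ballot p a (Suc (Suc h)) + (1 - p) * ballot p (Suc a) h"

text \<open>
A race is decided after boundedly many points, and as long as only boundedly many clocks have rung,
the odds of the next point are asymptotically those of \<open>n\<close> against \<open>n\<close> clocks. The offsets \<open>i\<close> and \<open>j\<close>
count the clocks that have rung; they must be arbitrary for the induction.
\<close>

lemma race_tendsto_ballot:
  assumes "q > 0"
  shows "(\<lambda>n. race q a h (n - i) (n - j)) \<longlonglongrightarrow> ballot (1 / (1 + q)) a h"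
proof (induction "1 / (1 + q)" a h arbitrary: i j rule: ballot.induct)
  case (3 a h)
  have e: "\<forall>\<^sub>F n in sequentially. race q (Suc a) (Suc h) (n - i) (n - j) =
      ((real n - real i) / ((real n - real i) + q * (real n - real j))) * race q a (Suc (Suc h)) (n - Suc i) (n - j)
      + (q * (real n - real j) / ((real n - real i) + q * (real n - real j))) * race q (Suc a) h (n - i) (n - Suc j)"
    using eventually_ge_at_top[of "max i j"]
    by eventually_elim (simp add: of_nat_diff add_divide_distrib)
  have 1: "(\<lambda>n. (real n - real i) / ((real n - real i) + q * (real n - real j))) \<longlonglongrightarrow> 1 / (1 + q)"
    using assms by real_asymp (simp add: field_simps)
  have 2: "(\<lambda>n. q * (real n - real j) / ((real n - real i) + q * (real n - real j))) \<longlonglongrightarrow> 1 - 1 / (1 + q)"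
    using assms by real_asymp (simp add: field_simps)
  show ?case
    unfolding tendsto_cong[OF e] ballot.simps
    by (intro tendsto_add tendsto_mult 1 2 3)
qed auto

section \<open>Ballot numbers and the coefficients of the limit law\<close>

text \<open>
The index \<open>m\<close> is the number of down steps before the final up step. The difference of binomial
coefficients is the reflection principle: all paths minus those that hit the barrier.
The recursion for \<open>ballot\<close> turns into Pascal's rule for these numbers; a formal term with
\<open>m = a + h\<close> is zero by symmetry, which lets all the sums have convenient ranges.
\<close>

lemma ballot_closed_form:
  "ballot p (Suc a) h =
     p ^ Suc a * (\<Sum>m\<le>a + h. (real ((a + m) choose a) - real ((a + m) choose (a + h))) * (1 - p) ^ m)"
proof (induction p "Suc a" h arbitrary: a rule: ballot.induct)
  case (2 p a)
  then show ?case by simp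
next
  case (3 p a h)
  let ?w = "\<lambda>a h m. real ((a + m) choose a) - real ((a + m) choose (a + h))"
  have Y: "ballot p (Suc a) h = p ^ Suc a * (\<Sum>m\<le>a + h. ?w a h m * (1 - p) ^ m)"
    using 3(2) by simp
  have shift: "(\<Sum>m\<le>a + Suc h. ?w a (Suc h) m * (1 - p) ^ m)
      = 1 + (\<Sum>m\<le>a + h. ?w a (Suc h) (Suc m) * (1 - p) ^ Suc m)"
    by (subst add_Suc_right, subst sum.atMost_Suc_shift) simp
  show ?case
  proof (cases a)
    case 0
    have "ballot p (Suc a) (Suc h) = p + (1 - p) * (p * (\<Sum>m\<le>h. ?w 0 h m * (1 - p) ^ m))"
      using Y 0 by simp
    also have "(\<Sum>m\<le>h. ?w 0 h m * (1 - p) ^ m) = (\<Sum>m\<le>h. ?w 0 (Suc h) (Suc m) * (1 - p) ^ m)"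
      by (rule sum.cong) auto
    finally show ?thesis
      unfolding shift using 0 by (simp add: algebra_simps sum_distrib_left)
  next
    case (Suc b)
    have X: "ballot p a (Suc (Suc h)) = p ^ a * (\<Sum>m\<le>a + Suc h. ?w b (Suc (Suc h)) m * (1 - p) ^ m)"
      using 3(1)[of b] Suc by simp
    have X': "(\<Sum>m\<le>a + Suc h. ?w b (Suc (Suc h)) m * (1 - p) ^ m)
       = 1 + (\<Sum>m\<le>a + h. ?w b (Suc (Suc h)) (Suc m) * (1 - p) ^ Suc m)"
      by (subst add_Suc_right, subst sum.atMost_Suc_shift) simp
    have W: "?w a (Suc h) (Suc m) = ?w b (Suc (Suc h)) (Suc m) + ?w a h m" for m
      using Suc by (simp add: algebra_simps)
    have "ballot p (Suc a) (Suc h) = p ^ Suc a * (1 + (\<Sum>m\<le>a + h. ?w b (Suc (Suc h)) (Suc m) * (1 - p) ^ Suc m)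
        + (1 - p) * (\<Sum>m\<le>a + h. ?w a h m * (1 - p) ^ m))"
      by (simp only: ballot.simps X X' Y) (simp add: algebra_simps)
    also have "\<dots> = p ^ Suc a * (1 + (\<Sum>m\<le>a + h. (?w b (Suc (Suc h)) (Suc m) + ?w a h m) * (1 - p) ^ Suc m))"
    proof -
      have "(1 - p) * (\<Sum>m\<le>a + h. ?w a h m * (1 - p) ^ m) = (\<Sum>m\<le>a + h. ?w a h m * (1 - p) ^ Suc m)"
        unfolding sum_distrib_left by (intro sum.cong refl) simp
      then show ?thesis by (simp only: distrib_right sum.distrib add.assoc)
    qed
    finally show ?thesis unfolding shift W .
  qed
qed

lemma choose_mult_shift: "((a + m) choose a) * (m choose j) = ((a + j) choose a) * ((a + m) choose (a + j))"
proof (cases "j \<le> m")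
  case True
  have "real (((a + m) choose a) * (m choose j)) = real (((a + j) choose a) * ((a + m) choose (a + j)))"
    using True by (simp add: binomial_fact)
  then show ?thesis by (simp only: of_nat_eq_iff)
qed (simp add: binomial_eq_0)

lemma sum_choose_hockey: "(\<Sum>m\<le>n. (a + m) choose (a + j)) = Suc (a + n) choose Suc (a + j)"
proof (induction n)
  case 0
  show ?case by (cases j) auto
next
  case (Suc n)
  then show ?case
    by (simp only: sum.atMost_Suc add_Suc_right Suc.IH
        binomial_Suc_Suc[of "Suc (a + n)" "a + j"] add.commute[of "Suc (a + n) choose (a + j)"])
qed

text \<open>
Trinomial revision moves the dependence on \<open>m\<close> into a single binomial coefficient, and the
hockey stick identity sums it.
\<close>

lemma sum_choose_mult_choose:
  "(\<Sum>m\<le>n. ((a + m) choose a) * (m choose j)) = ((a + j) choose a) * (Suc (a + n) choose Suc (a + j))"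
  unfolding choose_mult_shift sum_distrib_left[symmetric] sum_choose_hockey ..

text \<open>
Expanding \<open>(1 - p) ^ m\<close> in powers of \<open>p\<close> turns the ballot numbers into these sums. Both parts of the
ballot number are summed by \<open>sum_choose_mult_choose\<close>, and all the binomial coefficients that occur are
rational multiples of \<open>C\<close> and \<open>T\<close>, so that a rational identity in \<open>L\<close> and \<open>j\<close> remains.
\<close>

lemma sum_ballot_numbers_eq_B:
  assumes "j \<le> L"
  shows "(\<Sum>m\<le>L. (real ((L + m) choose L) - real ((L + m) choose (L + 1))) * real (m choose j)) = B L j"
proof -
  define T where "T = real ((2 * L + 1) choose (L + j + 1))"
  define C where "C = real ((L + j) choose L)"
  have 1: "(\<Sum>m\<le>L. ((L + m) choose L) * (m choose j)) = ((L + j) choose L) * ((2 * L + 1) choose (L + j + 1))"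
    by (simp add: sum_choose_mult_choose mult_2)
  have 2: "real (\<Sum>m\<le>L. ((L + m) choose (L + 1)) * (m choose j))
     = real ((L + 1 + j) choose (L + 1)) * real ((2 * L + 1) choose (L + j + 2))
       + real ((L + j) choose (L + 1)) * T"
  proof (cases L)
    case 0 then show ?thesis using assms by (simp add: T_def)
  next
    case (Suc K)
    \<comment> \<open>the term for 0 vanishes; after an index shift, Pascal's rule for Suc m choose j gives two summable parts\<close>
    have "(\<Sum>m\<le>L. ((L + m) choose (L + 1)) * (m choose j)) =
      (\<Sum>m\<le>K. ((L + 1 + m) choose (L + 1)) * (Suc m choose j))"
      unfolding Suc by (subst sum.atMost_Suc_shift) simp
    also have "\<dots> = ((L + 1 + j) choose (L + 1)) * ((2 * L + 1) choose (L + j + 2))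
       + ((L + j) choose (L + 1)) * ((2 * L + 1) choose (L + j + 1))"
    proof (cases j)
      case 0
      then show ?thesis using sum_choose_mult_choose[of "L+1" 0 K] Suc by (simp add: mult_2 del: binomial_Suc_Suc)
    next
      case (Suc i)
      have "(\<Sum>m\<le>K. ((L + 1 + m) choose (L + 1)) * (Suc m choose j)) =
          (\<Sum>m\<le>K. ((L + 1 + m) choose (L + 1)) * (m choose i))
          + (\<Sum>m\<le>K. ((L + 1 + m) choose (L + 1)) * (m choose j))"
        unfolding Suc binomial_Suc_Suc[of _ i] distrib_left sum.distrib ..
      then show ?thesis
        using Suc sum_choose_mult_choose[of "L+1" i K] sum_choose_mult_choose[of "L+1" j K] \<open>L = Suc K\<close>
        by (simp add: mult_2 del: binomial_Suc_Suc mult_Suc mult_Suc_right)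
    qed
    finally show ?thesis by (simp add: T_def)
  qed
  have c1: "real ((L + 1 + j) choose (L + 1)) * real (L + 1) = C * real (L + 1 + j)"
    unfolding C_def of_nat_mult[symmetric] of_nat_eq_iff
    using Suc_times_binomial_eq[of "L + j" L] by (simp del: binomial_Suc_Suc add: mult.commute)
  have c2: "real ((L + j) choose (L + 1)) * real (L + 1) = C * real j"
    unfolding C_def of_nat_mult[symmetric] of_nat_eq_iff
    using binomial_absorb_comp[of "L + j" L] binomial_absorption[of L "L + j"]
    by (simp del: binomial_Suc_Suc add: mult.commute)
  have c3: "real ((2 * L + 1) choose (L + j + 2)) * real (L + j + 2) = T * real (L - j)"
    unfolding T_def of_nat_mult[symmetric] of_nat_eq_iff
    using binomial_absorb_comp[of "2 * L + 1" "L + j + 1"] binomial_absorption[of "L + j + 1" "2 * L + 1"] assms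
    by (simp del: binomial_Suc_Suc add: mult.commute)
  have c4: "real ((2 * L + 2) choose (L - j)) * real (L + j + 2) = T * real (2 * L + 2)"
    unfolding T_def of_nat_mult[symmetric] of_nat_eq_iff
    using Suc_times_binomial_eq[of "2 * L + 1" "L + j + 1"] binomial_symmetric[of "L - j" "2 * L + 2"] assms
    by (simp del: binomial_Suc_Suc add: mult.commute)
  have e1: "real ((L + 1 + j) choose (L + 1)) = C * (L + 1 + j) / (L + 1)"
    and e2: "real ((L + j) choose (L + 1)) = C * j / (L + 1)"
    and e3: "real ((2 * L + 1) choose (L + j + 2)) = T * (real L - real j) / (L + j + 2)"
    and e4: "real ((2 * L + 2) choose (L - j)) = T * (2 * L + 2) / (L + j + 2)"
    using c1 c2 c3 c4 assms by (simp_all add: eq_divide_eq of_nat_diff)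
  have "(\<Sum>m\<le>L. (real ((L + m) choose L) - real ((L + m) choose (L + 1))) * real (m choose j))
     = real (\<Sum>m\<le>L. ((L + m) choose L) * (m choose j)) - real (\<Sum>m\<le>L. ((L + m) choose (L + 1)) * (m choose j))"
    by (simp add: algebra_simps sum_subtractf)
  also have "\<dots> = C * T - C * (L + 1 + j) / (L + 1) * (T * (real L - real j) / (L + j + 2)) - C * j / (L + 1) * T"
    unfolding 1 2 e1 e2 e3 by (simp add: C_def T_def)
  also have "\<dots> = B L j"
    unfolding B_def e4 C_def[symmetric]
    by (simp add: divide_simps) algebra
  finally show ?thesis .
qed

text \<open>
The formula for \<open>R\<close> is written in powers of \<open>k = 1 / p\<close>: its term with index \<open>j\<close> is a multiple of
\<open>k ^ (L - j) / k ^ (2 * L + 1) = p ^ (L + 1 + j)\<close>, where \<open>l = L + 1\<close>.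
\<close>

lemma ballot_eq_R:
  assumes "l \<ge> 1" "t > 0"
  shows "ballot (t / (1 + t)) l 1 = R l t"
proof -
  obtain L where L: "l = Suc L" using assms by (cases l) auto
  define p where "p = t / (1 + t)"
  have p: "p > 0" "1 + 1 / t = 1 / p" using assms by (auto simp: p_def field_simps)
  let ?w = "\<lambda>m. real ((L + m) choose L) - real ((L + m) choose (L + 1))"
  have "ballot p l 1 = p ^ Suc L * (\<Sum>m\<le>L. ?w m * (1 - p) ^ m)"
    unfolding L ballot_closed_form by (simp del: binomial_Suc_Suc)
      (simp add: binomial_symmetric[of L "Suc (L + L)"] algebra_simps)
  also have "(\<Sum>m\<le>L. ?w m * (1 - p) ^ m) = (\<Sum>m\<le>L. \<Sum>j\<le>L. ?w m * (real (m choose j) * (-p) ^ j))"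
  proof (rule sum.cong[OF refl])
    fix m assume m: "m \<in> {..L}"
    have "(1 - p) ^ m = (\<Sum>j\<le>m. real (m choose j) * (-p) ^ j)"
      using binomial_ring[of "-p" 1 m] by simp
    also have "\<dots> = (\<Sum>j\<le>L. real (m choose j) * (-p) ^ j)"
      using m by (intro sum.mono_neutral_left) auto
    finally show "?w m * (1 - p) ^ m = (\<Sum>j\<le>L. ?w m * (real (m choose j) * (-p) ^ j))"
      by (simp add: sum_distrib_left)
  qed
  also have "\<dots> = (\<Sum>j\<le>L. (\<Sum>m\<le>L. ?w m * real (m choose j)) * (-p) ^ j)"
    by (subst sum.swap) (simp add: sum_distrib_right mult.assoc)
  also have "\<dots> = (\<Sum>j\<le>L. B L j * (-p) ^ j)"
    by (simp add: sum_ballot_numbers_eq_B del: One_nat_def)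
  also have "p ^ Suc L * \<dots> = (\<Sum>j\<le>L. ((-1) ^ j * B L j * (1 / p) ^ (L - j)) / (1 / p) ^ (2 * L + 1))"
    unfolding sum_distrib_left
  proof (rule sum.cong[OF refl])
    fix j assume j: "j \<in> {..L}"
    then have e: "2 * L + 1 = Suc L + j + (L - j)" by simp
    show "p ^ Suc L * (B L j * (- p) ^ j) = ((-1) ^ j * B L j * (1 / p) ^ (L - j)) / (1 / p) ^ (2 * L + 1)"
      unfolding e power_add power_minus[of p j] using p by (simp add: power_one_over)
  qed
  also have "\<dots> = R l t"
    using assms unfolding R_def Let_def p L sum_divide_distrib[symmetric] by (simp add: atMost_atLeast0)
  finally show ?thesis unfolding p_def .
qed

section \<open>The first point of independent exponential clocks\<close>

definition exponential_measure :: "real \<Rightarrow> real measure" where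
  "exponential_measure q = density lborel (exponential_density q)"

lemma space_exponential_measure [simp]: "space (exponential_measure q) = UNIV"
  and sets_exponential_measure [simp, measurable_cong]: "sets (exponential_measure q) = sets borel"
  by (auto simp: exponential_measure_def)

lemma prob_space_exponential_measure: "q > 0 \<Longrightarrow> prob_space (exponential_measure q)"
  unfolding exponential_measure_def by (rule prob_space_exponential_density)

lemma emeasure_exponential_measure_greaterThan:
  assumes "q > 0" "s \<ge> 0"
  shows "emeasure (exponential_measure q) {s<..} = ennreal (exp (- s * q))"
proof -
  interpret prob_space "exponential_measure q" using assms by (rule_tac prob_space_exponential_measure)
  have "distributed (exponential_measure q) lborel (\<lambda>x. x) (exponential_density q)"
    using assms unfolding distributed_def exponential_measure_def
    by (auto simp: distr_id2 exponential_density_nonneg)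
  from exponential_distributedD_gt[OF this assms(2,1)] show ?thesis
    by (simp add: emeasure_eq_measure greaterThan_def)
qed

text \<open>
A clock of rate \<open>q\<close> rings at a time \<open>y > s\<close> while clocks of total rate \<open>w\<close> all ring after \<open>y\<close>: the integrand
is, up to the factor \<open>q / (q + w)\<close>, the density of a clock of rate \<open>q + w\<close>.
\<close>

lemma nn_integral_exponential_measure_tail:
  assumes "q > 0" "w \<ge> 0" "s \<ge> 0"
  shows "(\<integral>\<^sup>+ y. indicator {s<..} y * ennreal (exp (- y * w)) \<partial>exponential_measure q)
           = ennreal (q / (q + w) * exp (- s * (q + w)))"
proof -
  have "(\<integral>\<^sup>+ y. indicator {s<..} y * ennreal (exp (- y * w)) \<partial>exponential_measure q)
    = (\<integral>\<^sup>+ y. ennreal (exponential_density q y) * (indicator {s<..} y * ennreal (exp (- y * w))) \<partial>lborel)"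
    unfolding exponential_measure_def by (rule nn_integral_density) auto
  also have "\<dots> = (\<integral>\<^sup>+ y. ennreal (q / (q + w)) * (ennreal (exponential_density (q + w) y) * indicator {s<..} y) \<partial>lborel)"
  proof (intro nn_integral_cong)
    fix y :: real
    have "exp (- (y * (q + w))) = exp (- (y * q)) * exp (- (y * w))"
      by (simp add: distrib_left flip: exp_add)
    then show "ennreal (exponential_density q y) * (indicator {s<..} y * ennreal (exp (- y * w)))
      = ennreal (q / (q + w)) * (ennreal (exponential_density (q + w) y) * indicator {s<..} y)"
      using assms by (auto simp: exponential_density_def indicator_def simp flip: ennreal_mult)
  qed
  also have "\<dots> = ennreal (q / (q + w)) * emeasure (exponential_measure (q + w)) {s<..}"
    by (simp add: nn_integral_cmult emeasure_density exponential_measure_def)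
  also have "\<dots> = ennreal (q / (q + w) * exp (- s * (q + w)))"
    using assms by (simp add: emeasure_exponential_measure_greaterThan flip: ennreal_mult)
  finally show ?thesis .
qed

context
  fixes q :: "'i \<Rightarrow> real"
  assumes q_pos: "\<And>i. q i > 0"
begin

interpretation product_prob_space "\<lambda>i. exponential_measure (q i)" I for I
  by (simp add: product_prob_spaceI prob_space_exponential_measure q_pos)

abbreviation (input) "PE I \<equiv> Pi\<^sub>M I (\<lambda>i. exponential_measure (q i))"

lemma sets_PiM_exponential_greaterThan:
  assumes "finite J"
  shows "{z \<in> space (PE J). \<forall>c\<in>J. s < z c} \<in> sets (PE J)"
proof -
  have "{z \<in> space (PE J). \<forall>c\<in>J. s < z c} = Pi\<^sub>E J (\<lambda>_. {s<..})"
    by (auto simp: space_PiM PiE_def)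
  then show ?thesis using assms by (auto intro!: sets_PiM_I_finite)
qed

lemma emeasure_PiM_exponential_greaterThan:
  assumes "finite J" "s \<ge> 0"
  shows "emeasure (PE J) {z \<in> space (PE J). \<forall>c\<in>J. s < z c} = ennreal (exp (- s * (\<Sum>c\<in>J. q c)))"
proof -
  have "{z \<in> space (PE J). \<forall>c\<in>J. s < z c} = Pi\<^sub>E J (\<lambda>_. {s<..})"
    by (auto simp: space_PiM PiE_def)
  also have "emeasure (PE J) \<dots> = (\<Prod>c\<in>J. ennreal (exp (- s * q c)))"
    using assms q_pos by (subst emeasure_PiM) (auto simp: emeasure_exponential_measure_greaterThan)
  also have "\<dots> = ennreal (exp (- s * (\<Sum>c\<in>J. q c)))"
    using assms by (simp add: prod_ennreal exp_sum sum_distrib_left)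
  finally show ?thesis .
qed

lemma pred_PiM_exponential_first:
  assumes "finite J" "c \<in> J"
  shows "Measurable.pred (PE J) (\<lambda>z. s < z c \<and> (\<forall>d\<in>J-{c}. z c < z d))"
proof -
  have comp: "(\<lambda>z. z d) \<in> borel_measurable (PE J)" if "d \<in> J" for d
    using measurable_component_singleton[OF that, of "\<lambda>i. exponential_measure (q i)"]
    unfolding measurable_cong_sets[OF refl sets_exponential_measure] .
  show ?thesis
    using assms by (intro pred_intros_logic pred_intros_finite borel_measurable_pred_less comp) auto
qed

text \<open>
Fubini, with the time \<open>y\<close> of the clock that rings first as the outer variable.
\<close>

lemma emeasure_PiM_exponential_first:
  assumes "finite J" "c \<in> J" and S[measurable]: "Measurable.pred (PE J) S"
  shows "emeasure (PE J) {z \<in> space (PE J). s < z c \<and> (\<forall>d\<in>J-{c}. z c < z d) \<and> S z}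
       = (\<integral>\<^sup>+ y. indicator {s<..} y *
            emeasure (PE (J-{c})) {w \<in> space (PE (J-{c})). (\<forall>d\<in>J-{c}. y < w d) \<and> S (w(c := y))}
          \<partial>exponential_measure (q c))"
proof -
  let ?A = "{z \<in> space (PE J). s < z c \<and> (\<forall>d\<in>J-{c}. z c < z d) \<and> S z}"
  note [measurable] = pred_PiM_exponential_first[OF assms(1,2), of s]
  have "{z \<in> space (PE J). (s < z c \<and> (\<forall>d\<in>J-{c}. z c < z d)) \<and> S z} \<in> sets (PE J)"
    by measurable
  then have [measurable]: "?A \<in> sets (PE J)"
    by (simp only: conj_assoc)
  have "emeasure (PE J) ?A = integral\<^sup>N (PE J) (indicator ?A)" by simp
  also have "\<dots> = (\<integral>\<^sup>+ y. (\<integral>\<^sup>+ w. indicator ?A (w(c := y)) \<partial>PE (J - {c})) \<partial>exponential_measure (q c))"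
    using product_nn_integral_insert_rev[of "J - {c}" c "indicator ?A"] assms by (simp add: insert_absorb)
  also have "\<dots> = (\<integral>\<^sup>+ y. indicator {s<..} y *
            emeasure (PE (J-{c})) {w \<in> space (PE (J-{c})). (\<forall>d\<in>J-{c}. y < w d) \<and> S (w(c := y))}
          \<partial>exponential_measure (q c))"
  proof (intro nn_integral_cong)
    fix y
    have u[measurable]: "(\<lambda>w. w(c := y)) \<in> measurable (PE (J - {c})) (PE J)"
      by (rule measurable_fun_upd[where J = "J - {c}"]) (use assms in auto)
    have "(\<integral>\<^sup>+ w. indicator ?A (w(c := y)) \<partial>PE (J - {c}))
      = (\<integral>\<^sup>+ w. indicator {s<..} y * indicator {w \<in> space (PE (J-{c})). (\<forall>d\<in>J-{c}. y < w d) \<and> S (w(c := y))} w \<partial>PE (J - {c}))"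
      using measurable_space[OF u] by (intro nn_integral_cong) (auto simp: indicator_def)
    also have "\<dots> = indicator {s<..} y * emeasure (PE (J-{c})) {w \<in> space (PE (J-{c})). (\<forall>d\<in>J-{c}. y < w d) \<and> S (w(c := y))}"
    proof -
      have "{w \<in> space (PE (J-{c})). \<forall>d\<in>J-{c}. y < w d} \<inter> {w \<in> space (PE (J-{c})). S (w(c := y))}
          \<in> sets (PE (J-{c}))"
        using assms measurable_compose[OF u S]
        by (intro sets.Int sets_PiM_exponential_greaterThan) (auto simp: pred_def)
      also have "{w \<in> space (PE (J-{c})). \<forall>d\<in>J-{c}. y < w d} \<inter> {w \<in> space (PE (J-{c})). S (w(c := y))}
          = {w \<in> space (PE (J-{c})). (\<forall>d\<in>J-{c}. y < w d) \<and> S (w(c := y))}" by auto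
      finally show ?thesis
        by (subst nn_integral_cmult) (auto intro!: borel_measurable_indicator)
    qed
    finally show "(\<integral>\<^sup>+ w. indicator ?A (w(c := y)) \<partial>PE (J - {c})) = \<dots>" .
  qed
  finally show ?thesis .
qed

text \<open>
A case distinction on the clock that rings first. The lower bound \<open>s\<close> on all clocks is what makes the
decomposition iterable: the inner measure has the shape of the left-hand side again, with bound \<open>y\<close>.

That ties have probability zero follows from a mass count: by the preceding lemmas the events
``\<open>c\<close> rings first, after \<open>s\<close>'' have probabilities \<open>q c / Q * exp (- s * Q)\<close>, where \<open>Q\<close> is the total rate, and
these already add up to the probability that all clocks ring after \<open>s\<close>.
\<close>

lemma first_point_decomposition:
  assumes "finite J" "J \<noteq> {}" "s \<ge> 0" and S[measurable]: "Measurable.pred (PE J) S"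
  shows "emeasure (PE J) {z \<in> space (PE J). (\<forall>c\<in>J. s < z c) \<and> S z}
       = (\<Sum>c\<in>J. \<integral>\<^sup>+ y. indicator {s<..} y *
            emeasure (PE (J-{c})) {w \<in> space (PE (J-{c})). (\<forall>d\<in>J-{c}. y < w d) \<and> S (w(c := y))}
          \<partial>exponential_measure (q c))"
proof -
  let ?F = "\<lambda>c z. s < z c \<and> (\<forall>d\<in>J-{c}. z c < z d)"
  let ?all = "{z \<in> space (PE J). \<forall>c\<in>J. s < z c}"
  let ?first = "\<Union>c\<in>J. {z \<in> space (PE J). ?F c z}"
  define Q where "Q = (\<Sum>c\<in>J. q c)"
  have Q: "Q > 0" unfolding Q_def using assms q_pos by (intro sum_pos) auto
  have meas: "{z \<in> space (PE J). ?F c z \<and> P z} \<in> sets (PE J)" if "c \<in> J" "Measurable.pred (PE J) P" for c P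
  proof -
    note [measurable] = pred_PiM_exponential_first[OF assms(1) that(1), of s] that(2)
    show ?thesis by measurable
  qed
  have sum: "(\<Sum>c\<in>J. emeasure (PE J) {z \<in> space (PE J). ?F c z \<and> P z})
      = emeasure (PE J) (\<Union>c\<in>J. {z \<in> space (PE J). ?F c z \<and> P z})" if "Measurable.pred (PE J) P" for P
  proof (rule sum_emeasure)
    show "disjoint_family_on (\<lambda>c. {z \<in> space (PE J). ?F c z \<and> P z}) J"
      unfolding disjoint_family_on_def by safe (metis (lifting) Diff_iff IntE less_asym mem_Collect_eq singletonD)
  qed (use meas[OF _ that] assms in auto)
  have mass: "emeasure (PE J) {z \<in> space (PE J). ?F c z} = ennreal (q c / Q * exp (- s * Q))" if "c \<in> J" for c
  proof -
    have "emeasure (PE J) {z \<in> space (PE J). ?F c z} =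
       (\<integral>\<^sup>+ y. indicator {s<..} y * ennreal (exp (- y * (\<Sum>d\<in>J-{c}. q d))) \<partial>exponential_measure (q c))"
    proof -
      have "indicator {s<..} y * emeasure (PE (J-{c})) {w \<in> space (PE (J-{c})). \<forall>d\<in>J-{c}. y < w d}
          = indicator {s<..} y * ennreal (exp (- y * (\<Sum>d\<in>J-{c}. q d)))" for y
        using assms emeasure_PiM_exponential_greaterThan[of "J - {c}" y] by (cases "s < y") auto
      then show ?thesis
        using emeasure_PiM_exponential_first[of J c "\<lambda>_. True" s] assms that by simp
    qed
    also have "\<dots> = ennreal (q c / Q * exp (- s * Q))"
    proof -
      have "Q = q c + sum q (J - {c})" unfolding Q_def by (rule sum.remove[OF assms(1) that])
      moreover have "0 \<le> sum q (J - {c})" by (intro sum_nonneg less_imp_le q_pos)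
      ultimately show ?thesis
        using nn_integral_exponential_measure_tail[OF q_pos _ \<open>s \<ge> 0\<close>] by simp
    qed
    finally show ?thesis .
  qed
  have "emeasure (PE J) ?first = (\<Sum>c\<in>J. ennreal (q c / Q * exp (- s * Q)))"
    using sum[of "\<lambda>_. True"] mass by simp
  also have "\<dots> = ennreal (\<Sum>c\<in>J. q c / Q * exp (- s * Q))"
    using Q q_pos by (intro sum_ennreal) (auto intro: less_imp_le)
  also have "(\<Sum>c\<in>J. q c / Q * exp (- s * Q)) = exp (- s * Q)"
    using Q by (simp flip: sum_distrib_right sum_divide_distrib add: Q_def)
  also have "ennreal (exp (- s * Q)) = emeasure (PE J) ?all"
    using assms by (simp add: Q_def emeasure_PiM_exponential_greaterThan)
  finally have eq: "emeasure (PE J) ?first = emeasure (PE J) ?all" .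
  have first: "?first \<in> sets (PE J)" using meas[of _ "\<lambda>_. True"] assms by auto
  have all: "?all \<in> sets (PE J)" using assms(1) by (rule sets_PiM_exponential_greaterThan)
  have sub: "?first \<subseteq> ?all"
    by safe (metis Diff_iff less_trans singletonD)
  have "emeasure (PE J) (?all - ?first) = 0"
    using emeasure_Diff[OF _ all first sub] eq by (simp add: P.emeasure_finite)
  then have "AE z in PE J. z \<notin> ?all - ?first"
    using first all by (intro AE_not_in) (auto simp: null_sets_def)
  then have "AE z in PE J. z \<in> {z \<in> space (PE J). (\<forall>c\<in>J. s < z c) \<and> S z}
      \<longleftrightarrow> z \<in> (\<Union>c\<in>J. {z \<in> space (PE J). ?F c z \<and> S z})"
    by eventually_elim (use sub in blast)
  moreover have "{z \<in> space (PE J). (\<forall>c\<in>J. s < z c) \<and> S z} \<in> sets (PE J)"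
  proof -
    have "?all \<inter> {z \<in> space (PE J). S z} \<in> sets (PE J)" using all S by (auto simp: pred_def)
    moreover have "?all \<inter> {z \<in> space (PE J). S z} = {z \<in> space (PE J). (\<forall>c\<in>J. s < z c) \<and> S z}" by auto
    ultimately show ?thesis by simp
  qed
  ultimately have "emeasure (PE J) {z \<in> space (PE J). (\<forall>c\<in>J. s < z c) \<and> S z}
     = emeasure (PE J) (\<Union>c\<in>J. {z \<in> space (PE J). ?F c z \<and> S z})"
    using meas[OF _ S] assms(1) by (intro emeasure_eq_AE sets.finite_UN) auto
  also have "\<dots> = (\<Sum>c\<in>J. emeasure (PE J) {z \<in> space (PE J). ?F c z \<and> S z})"
    by (rule sum[OF S, symmetric])
  also have "\<dots> = (\<Sum>c\<in>J. \<integral>\<^sup>+ y. indicator {s<..} y *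
            emeasure (PE (J-{c})) {w \<in> space (PE (J-{c})). (\<forall>d\<in>J-{c}. y < w d) \<and> S (w(c := y))}
          \<partial>exponential_measure (q c))"
    by (intro sum.cong refl) (simp only: conj_assoc emeasure_PiM_exponential_first[OF assms(1) _ S])
  finally show ?thesis .
qed

end

section \<open>The race between two families of exponential clocks\<close>

text \<open>
The event of winning the race, for clocks \<open>z\<close> indexed by \<open>J\<close>: the left summand of the index type belongs to
the side that has to lead. At every time, this side already has \<open>a\<close> points, or the number of
points of the other side is less than \<open>h\<close> plus its own number of points. It suffices to look
at the ringing times; the separate first conjunct is the requirement at the beginning, when no clock has rung.
\<close>

definition leads :: "(nat + nat) set \<Rightarrow> nat \<Rightarrow> nat \<Rightarrow> (nat + nat \<Rightarrow> real) \<Rightarrow> bool" where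
  "leads J a h z \<longleftrightarrow> (a = 0 \<or> 0 < h) \<and>
     (\<forall>c\<in>J. a \<le> card {d\<in>J. isl d \<and> z d \<le> z c} \<or>
        card {d\<in>J. \<not> isl d \<and> z d \<le> z c} < h + card {d\<in>J. isl d \<and> z d \<le> z c})"

lemma leads_0 [simp]: "leads J 0 h z"
  by (simp add: leads_def)

lemma not_leads_Suc_0 [simp]: "\<not> leads J (Suc a) 0 z"
  by (simp add: leads_def)

lemma card_insert_first:
  assumes "finite J" "c \<in> J" "P c" "z c \<le> s"
  shows "card {d\<in>J. P d \<and> z d \<le> s} = Suc (card {d\<in>J-{c}. P d \<and> z d \<le> (s::real)})"
proof -
  have "{d\<in>J. P d \<and> z d \<le> s} = insert c {d\<in>J-{c}. P d \<and> z d \<le> s}" using assms by auto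
  then show ?thesis using assms by simp
qed

text \<open>
The first clock \<open>c\<close> is counted at every ringing time, so removing it shifts the number of points needed
or the lead by one, as in the recursion for \<open>race\<close>. At its own ringing time it is the only point; the condition at
that time is the first conjunct in the definition of \<open>leads\<close> for the remaining race.
\<close>

lemma leads_remove_first:
  assumes J: "finite J" "c \<in> J" and first: "\<forall>d\<in>J-{c}. z c < z d"
  shows "leads J (Suc a) (Suc h) z \<longleftrightarrow>
     (if isl c then leads (J-{c}) a (Suc (Suc h)) z else leads (J-{c}) (Suc a) h z)"
proof -
  define NX where "NX e = card {d\<in>J-{c}. isl d \<and> z d \<le> z e}" for e
  define NY where "NY e = card {d\<in>J-{c}. \<not> isl d \<and> z d \<le> z e}" for e
  have none: "{d\<in>J-{c}. P d \<and> z d \<le> z c} = {}" for P using first by (auto simp: not_le)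
  have c0: "NX c = 0" "NY c = 0" unfolding NX_def NY_def none by simp_all
  have count: "card {d\<in>J. P d \<and> z d \<le> z e} = (if P c then 1 else 0) + card {d\<in>J-{c}. P d \<and> z d \<le> z e}"
    if "e \<in> J" for P e
  proof (cases "P c")
    case True
    have "z c \<le> z e" using that first by (cases "e = c") (auto intro: less_imp_le)
    then show ?thesis using card_insert_first[of J c P z "z e"] J True by simp
  next
    case False
    then have "{d\<in>J. P d \<and> z d \<le> z e} = {d\<in>J-{c}. P d \<and> z d \<le> z e}" by auto
    with False show ?thesis by simp
  qed
  have "leads J (Suc a) (Suc h) z \<longleftrightarrow> (\<forall>e\<in>J. Suc a \<le> card {d\<in>J. isl d \<and> z d \<le> z e} \<or>
        card {d\<in>J. \<not> isl d \<and> z d \<le> z e} < Suc h + card {d\<in>J. isl d \<and> z d \<le> z e})"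
    unfolding leads_def by simp
  also have "\<dots> \<longleftrightarrow> (\<forall>e\<in>J. Suc a \<le> (if isl c then 1 else 0) + NX e \<or>
        (if \<not> isl c then 1 else 0) + NY e < Suc h + ((if isl c then 1 else 0) + NX e))"
    by (rule ball_cong[OF refl]) (simp only: count NX_def NY_def)
  also have "\<dots> \<longleftrightarrow> (if isl c then \<forall>e\<in>J-{c}. a \<le> NX e \<or> NY e < Suc (Suc h) + NX e
        else 0 < h \<and> (\<forall>e\<in>J-{c}. Suc a \<le> NX e \<or> NY e < h + NX e))" (is "?l \<longleftrightarrow> ?r")
  proof -
    have split: "(\<forall>e\<in>J. P e) \<longleftrightarrow> P c \<and> (\<forall>e\<in>J-{c}. P e)" for P using J by auto
    show ?thesis by (subst split) (cases "isl c"; simp add: c0)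
  qed
  also have "\<dots> \<longleftrightarrow> (if isl c then leads (J-{c}) a (Suc (Suc h)) z else leads (J-{c}) (Suc a) h z)"
    unfolding leads_def NX_def NY_def by simp
  finally show ?thesis .
qed

lemma leads_fun_upd:
  assumes "c \<notin> J"
  shows "leads J a h (w(c := y)) = leads J a h w"
proof -
  have "{d\<in>J. P d \<and> (w(c := y)) d \<le> (w(c := y)) e} = {d\<in>J. P d \<and> w d \<le> w e}" if "e \<in> J" for P e
    using that assms by auto
  then show ?thesis unfolding leads_def by (simp del: fun_upd_apply cong: ball_cong)
qed

lemma measurable_card_filter:
  assumes "finite J" "\<And>d. d \<in> J \<Longrightarrow> Measurable.pred M (P d)"
  shows "(\<lambda>x. card {d\<in>J. P d x}) \<in> measurable M (count_space UNIV)"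
proof -
  have eq: "(\<lambda>x. card {d\<in>J. P d x}) = (\<lambda>x. \<Sum>d\<in>J. if P d x then 1 else 0)"
    using assms by (auto simp: sum.If_cases Int_def)
  show ?thesis unfolding eq using assms by measurable
qed

definition side_rate :: "real \<Rightarrow> nat + nat \<Rightarrow> real" where
  "side_rate q c = (if isl c then 1 else q)"

abbreviation race_measure :: "real \<Rightarrow> (nat + nat) set \<Rightarrow> (nat + nat \<Rightarrow> real) measure" where
  "race_measure q J \<equiv> Pi\<^sub>M J (\<lambda>c. exponential_measure (side_rate q c))"

lemma pred_leads:
  assumes "finite J"
  shows "Measurable.pred (race_measure q J) (leads J a h)"
proof -
  have comp: "(\<lambda>z. z d) \<in> borel_measurable (race_measure q J)" if "d \<in> J" for d
    using measurable_component_singleton[OF that, of "\<lambda>c. exponential_measure (side_rate q c)"]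
    unfolding measurable_cong_sets[OF refl sets_exponential_measure] .
  have count: "(\<lambda>z. card {d\<in>J. P d \<and> z d \<le> z e}) \<in> measurable (race_measure q J) (count_space UNIV)"
    if "e \<in> J" for P e
    using assms that unfolding not_less[symmetric]
    by (intro measurable_card_filter pred_intros_conj1' pred_intros_logic(2) borel_measurable_pred_less comp) auto
  have "Measurable.pred (race_measure q J) (\<lambda>z. a \<le> card {d\<in>J. isl d \<and> z d \<le> z c} \<or>
        card {d\<in>J. \<not> isl d \<and> z d \<le> z c} < h + card {d\<in>J. isl d \<and> z d \<le> z c})" if "c \<in> J" for c
  proof -
    have "Measurable.pred N (\<lambda>x. a \<le> f x \<or> g x < h + f x)"
      if f: "f \<in> measurable N (count_space UNIV)" and g: "g \<in> measurable N (count_space UNIV)"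
      for N :: "(nat + nat \<Rightarrow> real) measure" and f g :: "_ \<Rightarrow> nat"
    proof (rule measurable_compose_countable[OF _ f])
      show "Measurable.pred N (\<lambda>x. a \<le> m \<or> g x < h + m)" for m
        by (rule measurable_compose[OF g]) simp
    qed
    from this[OF count[OF that] count[OF that]] show ?thesis .
  qed
  then show ?thesis
    unfolding leads_def using assms
    by (intro pred_intros_conj1' pred_intros_finite(3)) auto
qed

lemma race_nonneg: "q > 0 \<Longrightarrow> 0 \<le> race q a h x y"
  by (induction q a h x y rule: race.induct) auto

lemma side_rate_pos: "q > 0 \<Longrightarrow> side_rate q c > 0"
  by (simp add: side_rate_def)

lemma sum_side_rate:
  "finite J \<Longrightarrow> (\<Sum>c\<in>J. side_rate q c) = real (card {c\<in>J. isl c}) + q * real (card {c\<in>J. \<not> isl c})"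
  by (simp add: side_rate_def sum.If_cases Collect_conj_eq Collect_neg_eq)

text \<open>
Memorylessness in the form needed here: the probability that all clocks ring after \<open>s\<close> and that the race
is won is the product of the two probabilities. With this factor the first-point decomposition reproduces the recursion
for \<open>race\<close>, since every inner probability is an exponential in \<open>y\<close> times a constant. The bound on
\<open>a\<close> ensures that clocks remain as long as the race is open, and is preserved by both kinds of steps.
\<close>

lemma emeasure_race_leads:
  assumes "q > 0" "finite J" "s \<ge> 0" "a \<le> card {c\<in>J. isl c}"
  shows "emeasure (race_measure q J) {z \<in> space (race_measure q J). (\<forall>c\<in>J. s < z c) \<and> leads J a h z}
     = ennreal (race q a h (card {c\<in>J. isl c}) (card {c\<in>J. \<not> isl c}) * exp (- s * (\<Sum>c\<in>J. side_rate q c)))"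
  using assms
proof (induction q a h "card {c\<in>J. isl c}" "card {c\<in>J. \<not> isl c}" arbitrary: J s rule: race.induct)
  case (1 q h J s)
  then show ?case
    using emeasure_PiM_exponential_greaterThan[of "side_rate q" J s] side_rate_pos by simp
next
  case (2 q a J s)
  then show ?case by simp
next
  case (3 q a h J s)
  note q = \<open>q > 0\<close> and J = \<open>finite J\<close> and s = \<open>s \<ge> 0\<close>
  let ?x = "card {c\<in>J. isl c}" and ?y = "card {c\<in>J. \<not> isl c}"
  let ?X = "race q a (Suc (Suc h)) (?x - 1) ?y" and ?Y = "race q (Suc a) h ?x (?y - 1)"
  define Q where "Q = (\<Sum>c\<in>J. side_rate q c)"
  have Q: "Q = real ?x + q * real ?y" unfolding Q_def by (rule sum_side_rate[OF J])
  have "?x > 0" using 3 by linarith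
  then have "J \<noteq> {}" by auto
  have "Q > 0" unfolding Q_def using J \<open>J \<noteq> {}\<close> side_rate_pos[OF q] by (intro sum_pos) auto
  define V where "V c = (if isl c then ?X else ?Y)" for c :: "nat + nat"
  have V: "V c \<ge> 0" for c using q by (simp add: V_def race_nonneg)
  have step: "(\<integral>\<^sup>+ y. indicator {s<..} y * emeasure (race_measure q (J - {c}))
        {w \<in> space (race_measure q (J - {c})). (\<forall>d\<in>J - {c}. y < w d) \<and> leads J (Suc a) (Suc h) (w(c := y))}
        \<partial>exponential_measure (side_rate q c)) = ennreal (side_rate q c * V c * (exp (- s * Q) / Q))" if c: "c \<in> J" for c
  proof -
    let ?w = "\<Sum>d\<in>J-{c}. side_rate q d"
    have cards: "card {d\<in>J. d \<noteq> c \<and> P d} = card {d\<in>J. P d} - (if P c then 1 else 0)" for P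
    proof -
      have "{d\<in>J. d \<noteq> c \<and> P d} = {d\<in>J. P d} - {c}" by auto
      then show ?thesis using J c by (simp add: card_Diff_singleton)
    qed
    have em: "emeasure (race_measure q (J - {c}))
        {w \<in> space (race_measure q (J - {c})). (\<forall>d\<in>J - {c}. y < w d) \<and> leads J (Suc a) (Suc h) (w(c := y))}
        = ennreal (V c) * ennreal (exp (- y * ?w))" if y: "y > s" for y
    proof -
      have "{w \<in> space (race_measure q (J - {c})). (\<forall>d\<in>J - {c}. y < w d) \<and> leads J (Suc a) (Suc h) (w(c := y))}
        = {w \<in> space (race_measure q (J - {c})). (\<forall>d\<in>J - {c}. y < w d) \<and>
             (if isl c then leads (J-{c}) a (Suc (Suc h)) w else leads (J-{c}) (Suc a) h w)}"
      proof (intro Collect_cong conj_cong refl)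
        fix w assume "\<forall>d\<in>J - {c}. y < w d"
        then show "leads J (Suc a) (Suc h) (w(c := y)) \<longleftrightarrow>
            (if isl c then leads (J-{c}) a (Suc (Suc h)) w else leads (J-{c}) (Suc a) h w)"
          by (subst leads_remove_first[OF J c]) (auto simp: leads_fun_upd)
      qed
      also have "emeasure (race_measure q (J - {c})) \<dots> = ennreal (V c * exp (- y * ?w))"
      proof (cases "isl c")
        case True
        then show ?thesis using 3(1)[of "J - {c}" y] 3(3-) y by (simp add: cards V_def)
      next
        case False
        then show ?thesis using 3(2)[of "J - {c}" y] 3(3-) y by (simp add: cards V_def)
      qed
      finally show ?thesis unfolding ennreal_mult'[OF V] .
    qed
    have "(\<integral>\<^sup>+ y. indicator {s<..} y * emeasure (race_measure q (J - {c}))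
        {w \<in> space (race_measure q (J - {c})). (\<forall>d\<in>J - {c}. y < w d) \<and> leads J (Suc a) (Suc h) (w(c := y))}
        \<partial>exponential_measure (side_rate q c))
      = (\<integral>\<^sup>+ y. ennreal (V c) * (indicator {s<..} y * ennreal (exp (- y * ?w))) \<partial>exponential_measure (side_rate q c))"
    proof (intro nn_integral_cong)
      fix y show "indicator {s<..} y * emeasure (race_measure q (J - {c}))
        {w \<in> space (race_measure q (J - {c})). (\<forall>d\<in>J - {c}. y < w d) \<and> leads J (Suc a) (Suc h) (w(c := y))}
        = ennreal (V c) * (indicator {s<..} y * ennreal (exp (- y * ?w)))"
        by (cases "s < y") (simp_all add: em)
    qed
    also have "\<dots> = ennreal (V c) * ennreal (side_rate q c / Q * exp (- s * Q))"
    proof -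
      have "Q = side_rate q c + ?w" unfolding Q_def by (rule sum.remove[OF J c])
      moreover have "0 \<le> ?w" by (intro sum_nonneg less_imp_le side_rate_pos[OF q])
      ultimately show ?thesis
        using nn_integral_exponential_measure_tail[OF side_rate_pos[OF q] _ s] by (subst nn_integral_cmult) simp_all
    qed
    also have "\<dots> = ennreal (V c * (side_rate q c / Q * exp (- s * Q)))"
      by (rule ennreal_mult'[OF V, symmetric])
    also have "V c * (side_rate q c / Q * exp (- s * Q)) = side_rate q c * V c * (exp (- s * Q) / Q)"
      by simp
    finally show ?thesis .
  qed
  have "emeasure (race_measure q J) {z \<in> space (race_measure q J). (\<forall>c\<in>J. s < z c) \<and> leads J (Suc a) (Suc h) z}
     = (\<Sum>c\<in>J. ennreal (side_rate q c * V c * (exp (- s * Q) / Q)))"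
    unfolding first_point_decomposition[OF side_rate_pos[OF q] J \<open>J \<noteq> {}\<close> s pred_leads[OF J]]
    by (rule sum.cong[OF refl step])
  also have "\<dots> = ennreal ((\<Sum>c\<in>J. side_rate q c * V c) * (exp (- s * Q) / Q))"
    using V side_rate_pos[OF q] \<open>Q > 0\<close>
    unfolding sum_distrib_right by (intro sum_ennreal) (simp add: less_imp_le)
  also have "(\<Sum>c\<in>J. side_rate q c * V c) = real ?x * ?X + q * real ?y * ?Y"
  proof -
    have "(\<Sum>c\<in>J. side_rate q c * V c) = (\<Sum>c\<in>J. if isl c then ?X else q * ?Y)"
      by (intro sum.cong) (auto simp: side_rate_def V_def)
    then show ?thesis using J by (simp add: sum.If_cases Collect_conj_eq Collect_neg_eq)
  qed
  also have "(real ?x * ?X + q * real ?y * ?Y) * (exp (- s * Q) / Q) = race q (Suc a) (Suc h) ?x ?y * exp (- s * Q)"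
    unfolding race.simps Q by (simp only: times_divide_eq_left times_divide_eq_right)
  finally show ?case unfolding Q_def .
qed

section \<open>Order statistics as counts of points\<close>

lemma sorted_nth_le_iff:
  "sorted xs \<Longrightarrow> i < length xs \<Longrightarrow> xs ! i \<le> s \<longleftrightarrow> i < length (filter (\<lambda>x. x \<le> s) xs)"
proof (induction xs arbitrary: i)
  case (Cons x xs)
  have none: "filter (\<lambda>x. x \<le> s) xs = []" if "s < x"
    using that Cons.prems by (auto simp: filter_empty_conv)
  show ?case
  proof (cases "x \<le> s")
    case True
    then show ?thesis using Cons by (cases i) auto
  next
    case False
    then show ?thesis using Cons none by (cases i) auto
  qed
qed simp

text \<open>
Sorting does not change the number of entries below \<open>s\<close>, and in a sorted list they form an initial segment.
This duality with counts of points replaces sorting in what follows.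
\<close>

lemma order_stat_le_iff:
  assumes "i \<in> {1..n}"
  shows "order_stat X n i \<omega> \<le> s \<longleftrightarrow> i \<le> card {j\<in>{..<n}. X j \<omega> \<le> s}"
proof -
  have "length (filter (\<lambda>x. x \<le> s) (sort (map (\<lambda>j. X j \<omega>) [0..<n])))
      = length (filter (\<lambda>x. x \<le> s) (map (\<lambda>j. X j \<omega>) [0..<n]))"
    by (simp add: filter_sort)
  also have "\<dots> = card {j. j < n \<and> X j \<omega> \<le> s}"
    by (simp add: length_filter_conv_card cong: conj_cong)
  finally show ?thesis
    using assms unfolding order_stat_def by (subst sorted_nth_le_iff) auto
qed

lemma order_stat_mem:
  assumes "i \<in> {1..n}"
  obtains j where "j < n" "order_stat X n i \<omega> = X j \<omega>"
proof -
  have "order_stat X n i \<omega> \<in> set (sort (map (\<lambda>j. X j \<omega>) [0..<n]))"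
    unfolding order_stat_def using assms by (intro nth_mem) auto
  then show ?thesis using that by auto
qed

lemma borel_measurable_order_stat:
  assumes "\<And>j. X j \<in> borel_measurable M" "i \<in> {1..n}"
  shows "order_stat X n i \<in> borel_measurable M"
  unfolding borel_measurable_iff_le order_stat_le_iff[OF assms(2)]
proof
  fix s
  have "(\<lambda>\<omega>. card {j\<in>{..<n}. X j \<omega> \<le> s}) \<in> measurable M (count_space UNIV)"
  proof (rule measurable_card_filter)
    show "Measurable.pred M (\<lambda>\<omega>. X j \<omega> \<le> s)" for j
      using assms(1)[of j] unfolding pred_def borel_measurable_iff_le by blast
  qed simp
  then have "Measurable.pred M (\<lambda>\<omega>. i \<le> card {j\<in>{..<n}. X j \<omega> \<le> s})"
    by (rule measurable_compose) simp
  then show "{\<omega> \<in> space M. i \<le> card {j\<in>{..<n}. X j \<omega> \<le> s}} \<in> sets M"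
    unfolding pred_def .
qed

lemma borel_measurable_max_ratio:
  assumes "\<And>j. X j \<in> borel_measurable M" "\<And>j. Y j \<in> borel_measurable M" "l \<le> n"
  shows "max_ratio X Y l n \<in> borel_measurable M"
proof -
  have "(\<lambda>\<omega>. MAX i\<in>{1..l}. order_stat X n i \<omega> / order_stat Y n i \<omega>) \<in> borel_measurable M"
    using assms by (intro borel_measurable_Max borel_measurable_divide borel_measurable_order_stat) auto
  then show ?thesis unfolding max_ratio_def[abs_def] .
qed

lemma max_ratio_pos:
  assumes "\<And>j. X j \<omega> > 0" "\<And>j. Y j \<omega> > 0" "1 \<le> l" "l \<le> n"
  shows "max_ratio X Y l n \<omega> > 0"
proof -
  have pos: "order_stat V n 1 \<omega> > 0" if "\<And>j. V j \<omega> > 0" for V :: "nat \<Rightarrow> _ \<Rightarrow> real"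
  proof -
    have "1 \<in> {1..n}" using assms(3,4) by simp
    then obtain j where "order_stat V n 1 \<omega> = V j \<omega>" using order_stat_mem[of 1 n V \<omega>] by blast
    then show ?thesis using that by simp
  qed
  have "0 < order_stat X n 1 \<omega> / order_stat Y n 1 \<omega>"
    using assms by (intro divide_pos_pos pos) auto
  also have "\<dots> \<le> max_ratio X Y l n \<omega>"
    unfolding max_ratio_def using assms(3) by (intro Max_ge) auto
  finally show ?thesis .
qed

lemma card_Plus_filter:
  "card {d\<in>A <+> D. isl d \<and> z d \<le> s} = card {j\<in>A. z (Inl j) \<le> (s::real)}"
  "card {d\<in>A <+> D. \<not> isl d \<and> z d \<le> s} = card {j\<in>D. z (Inr j) \<le> s}"
proof -
  have "{d\<in>A <+> D. isl d \<and> z d \<le> s} = Inl ` {j\<in>A. z (Inl j) \<le> s}"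
    "{d\<in>A <+> D. \<not> isl d \<and> z d \<le> s} = Inr ` {j\<in>D. z (Inr j) \<le> s}" by auto
  then show "card {d\<in>A <+> D. isl d \<and> z d \<le> s} = card {j\<in>A. z (Inl j) \<le> (s::real)}"
    "card {d\<in>A <+> D. \<not> isl d \<and> z d \<le> s} = card {j\<in>D. z (Inr j) \<le> s}"
    by (simp_all add: card_image)
qed

text \<open>
By duality with counts, the condition on the order statistics says that whenever \<open>t * Y\<close> has \<open>i \<le> l\<close>
points so far, then so has \<open>X\<close>; that is, among the first \<open>l\<close> points \<open>X\<close> is never behind.
For the first direction, a violation at some time gives a violated index, one more than the
number of points of \<open>X\<close> at that time.
\<close>

lemma max_ratio_le_iff_leads:
  assumes Y: "\<And>j. Y j \<omega> > 0" and t: "t > 0" and l: "1 \<le> l" "l \<le> n"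
  shows "max_ratio X Y l n \<omega> \<le> t \<longleftrightarrow>
    leads ({..<n} <+> {..<n}) l 1 (case_sum (\<lambda>j. X j \<omega>) (\<lambda>j. t * Y j \<omega>))"
proof -
  define NX where "NX s = card {j\<in>{..<n}. X j \<omega> \<le> s}" for s
  define NY where "NY s = card {j\<in>{..<n}. t * Y j \<omega> \<le> s}" for s
  let ?z = "case_sum (\<lambda>j. X j \<omega>) (\<lambda>j. t * Y j \<omega>)" and ?J = "{..<n} <+> {..<n}"
  have X_le: "order_stat X n i \<omega> \<le> s \<longleftrightarrow> i \<le> NX s" if "i \<in> {1..l}" for i s
    unfolding NX_def using that l by (intro order_stat_le_iff) auto
  have Y_le: "t * order_stat Y n i \<omega> \<le> s \<longleftrightarrow> i \<le> NY s" if "i \<in> {1..l}" for i s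
  proof -
    have "t * y \<le> s \<longleftrightarrow> y \<le> s / t" for y using t by (simp add: field_simps)
    then show ?thesis unfolding NY_def using that l order_stat_le_iff[of i n Y \<omega> "s / t"] by auto
  qed
  have Y_pos: "order_stat Y n i \<omega> > 0" if "i \<in> {1..l}" for i
  proof -
    have "i \<in> {1..n}" using that l by auto
    then obtain j where "order_stat Y n i \<omega> = Y j \<omega>" using order_stat_mem[of i n Y \<omega>] by blast
    then show ?thesis using Y by simp
  qed
  have leads: "leads ?J l 1 ?z \<longleftrightarrow> (\<forall>c\<in>?J. l \<le> NX (?z c) \<or> NY (?z c) \<le> NX (?z c))"
    unfolding leads_def card_Plus_filter by (simp add: NX_def NY_def less_Suc_eq_le)
  have "max_ratio X Y l n \<omega> \<le> t \<longleftrightarrow> (\<forall>i\<in>{1..l}. order_stat X n i \<omega> / order_stat Y n i \<omega> \<le> t)"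
    unfolding max_ratio_def using l by (subst Max_le_iff) auto
  also have "\<dots> \<longleftrightarrow> (\<forall>i\<in>{1..l}. order_stat X n i \<omega> \<le> t * order_stat Y n i \<omega>)"
    by (intro ball_cong refl) (simp add: pos_divide_le_eq Y_pos)
  also have "\<dots> \<longleftrightarrow> leads ?J l 1 ?z"
    unfolding leads
  proof (intro iffI ballI)
    fix c assume *: "\<forall>i\<in>{1..l}. order_stat X n i \<omega> \<le> t * order_stat Y n i \<omega>"
    let ?i = "Suc (NX (?z c))"
    show "l \<le> NX (?z c) \<or> NY (?z c) \<le> NX (?z c)"
    proof (rule ccontr)
      assume "\<not> (l \<le> NX (?z c) \<or> NY (?z c) \<le> NX (?z c))"
      then have i: "?i \<in> {1..l}" "?i \<le> NY (?z c)" by auto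
      have "order_stat X n ?i \<omega> \<le> t * order_stat Y n ?i \<omega>" using * i(1) by (rule bspec)
      also have "\<dots> \<le> ?z c" using Y_le[OF i(1)] i(2) by blast
      finally have "order_stat X n ?i \<omega> \<le> ?z c" .
      then show False using X_le[OF i(1)] by simp
    qed
  next
    fix i assume *: "\<forall>c\<in>?J. l \<le> NX (?z c) \<or> NY (?z c) \<le> NX (?z c)" and i: "i \<in> {1..l}"
    let ?s = "t * order_stat Y n i \<omega>"
    obtain j where "j < n" "order_stat Y n i \<omega> = Y j \<omega>"
    proof -
      have "i \<in> {1..n}" using i l by auto
      then show ?thesis using order_stat_mem[of i n Y \<omega>] that by blast
    qed
    then have "Inr j \<in> ?J" "?z (Inr j) = ?s" by auto
    then have "l \<le> NX ?s \<or> NY ?s \<le> NX ?s" using * by metis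
    moreover have "i \<le> NY ?s" using Y_le[OF i, of ?s] by simp
    ultimately show "order_stat X n i \<omega> \<le> ?s" using i X_le by auto
  qed
  finally show ?thesis .
qed

section \<open>The joint law of the two sequences\<close>

text \<open>
A finite set of indices in the sum type splits into a set for \<open>X\<close> and one for \<open>Y\<close>: independence of
the two sequences factors off the two halves, and independence within each sequence factors the halves.
\<close>

lemma indep_vars_case_sum:
  fixes X Y :: "nat \<Rightarrow> 'a \<Rightarrow> real"
  assumes "prob_space M"
    and X: "prob_space.indep_vars M (\<lambda>_. borel) X UNIV"
    and Y: "prob_space.indep_vars M (\<lambda>_. borel) Y UNIV"
    and XY: "indep_sequences M X Y"
  shows "prob_space.indep_vars M (\<lambda>_. borel) (case_sum X Y) UNIV"
proof -
  interpret prob_space M by fact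
  have [measurable]: "X j \<in> borel_measurable M" "Y j \<in> borel_measurable M" for j
    using X Y by (auto simp: indep_vars_def)
  have pre: "prob (\<Inter>j\<in>A. X' j -` E j \<inter> space M) = (\<Prod>j\<in>A. prob (X' j -` E j \<inter> space M))"
    if "indep_vars (\<lambda>_. borel) X' UNIV" "finite A" "A \<noteq> {}" "\<And>j. E j \<in> sets borel"
    for X' :: "nat \<Rightarrow> 'a \<Rightarrow> real" and E A
    using that by (intro indep_varsD) auto
  have pre': "prob ((\<lambda>\<omega> j. X' j \<omega>) -` {x. \<forall>j\<in>A. x j \<in> E j} \<inter> space M) = (\<Prod>j\<in>A. prob (X' j -` E j \<inter> space M))"
    if "indep_vars (\<lambda>_. borel) X' UNIV" "finite A" "\<And>j. E j \<in> sets borel"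
    for X' :: "nat \<Rightarrow> 'a \<Rightarrow> real" and E A
  proof (cases "A = {}")
    case False
    then have "(\<lambda>\<omega> j. X' j \<omega>) -` {x. \<forall>j\<in>A. x j \<in> E j} \<inter> space M = (\<Inter>j\<in>A. X' j -` E j \<inter> space M)" by auto
    then show ?thesis using pre[of X' A E] that False by simp
  qed (simp add: prob_space)
  show ?thesis
    unfolding indep_vars_def2
  proof (intro conjI ballI)
    fix c :: "nat + nat" show "random_variable borel (case_sum X Y c)" by (cases c) auto
    show "indep_sets (\<lambda>c. {case_sum X Y c -` A \<inter> space M |A. A \<in> sets borel}) UNIV"
      unfolding indep_sets_def
    proof (intro conjI ballI allI impI)
      fix c :: "nat + nat"
      show "{case_sum X Y c -` A \<inter> space M |A. A \<in> sets borel} \<subseteq> events"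
        by (cases c) auto
    next
      fix J :: "(nat + nat) set" and F
      assume "J \<noteq> {}" "finite J" and F: "F \<in> Pi J (\<lambda>c. {case_sum X Y c -` A \<inter> space M |A. A \<in> sets borel})"
      have "\<exists>E. E \<in> sets borel \<and> (c \<in> J \<longrightarrow> F c = case_sum X Y c -` E \<inter> space M)" for c
      proof (cases "c \<in> J")
        case True
        then have "F c \<in> {case_sum X Y c -` A \<inter> space M |A. A \<in> sets borel}" by (rule Pi_mem[OF F])
        then show ?thesis by blast
      next
        case False
        then show ?thesis by (intro exI[of _ "{}"]) simp
      qed
      then have "\<exists>E. \<forall>c. E c \<in> sets borel \<and> (c \<in> J \<longrightarrow> F c = case_sum X Y c -` E c \<inter> space M)"
        by (intro choice allI)
      then obtain E where E: "\<And>c. E c \<in> sets borel" "\<And>c. c \<in> J \<Longrightarrow> F c = case_sum X Y c -` E c \<inter> space M"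
        by blast
      define A D where "A = Inl -` J" and "D = Inr -` J"
      have AB: "finite A" "finite D"
        unfolding A_def D_def using \<open>finite J\<close> by (auto intro: finite_vimageI)
      have J: "J = A <+> D"
      proof (rule set_eqI)
        fix c show "c \<in> J \<longleftrightarrow> c \<in> A <+> D" by (cases c) (auto simp: A_def D_def)
      qed
      let ?S = "{x. \<forall>j\<in>A. x j \<in> E (Inl j)} :: (nat \<Rightarrow> real) set"
      let ?T = "{x. \<forall>j\<in>D. x j \<in> E (Inr j)} :: (nat \<Rightarrow> real) set"
      have meas: "{x. \<forall>j\<in>C. x j \<in> G j} \<in> sets (Pi\<^sub>M UNIV (\<lambda>_. borel))"
        if "finite C" "\<And>j. G j \<in> sets borel" for C :: "nat set" and G :: "nat \<Rightarrow> real set"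
      proof -
        have "{x \<in> space (Pi\<^sub>M UNIV (\<lambda>_. borel)). x j \<in> G j} \<in> sets (Pi\<^sub>M UNIV (\<lambda>_. borel))" for j
          using measurable_sets[OF measurable_component_singleton[of j UNIV "\<lambda>_. borel"] that(2)[of j]]
          by (simp add: vimage_def Int_def conj_commute)
        then have "{x \<in> space (Pi\<^sub>M UNIV (\<lambda>_. borel)). \<forall>j\<in>C. x j \<in> G j} \<in> sets (Pi\<^sub>M UNIV (\<lambda>_. borel))"
          using that(1) by (intro sets.sets_Collect_finite_All)
        then show ?thesis by (simp add: space_PiM)
      qed
      have "(\<Inter>c\<in>J. F c) = (\<lambda>\<omega>. (\<lambda>j. X j \<omega>, \<lambda>j. Y j \<omega>)) -` (?S \<times> ?T) \<inter> space M"
      proof -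
        have "(\<Inter>c\<in>J. F c) = {\<omega>\<in>space M. \<forall>c\<in>J. case_sum X Y c \<omega> \<in> E c}"
          using \<open>J \<noteq> {}\<close> E(2) by auto
        moreover have "(\<forall>c\<in>A <+> D. P c) \<longleftrightarrow> (\<forall>j\<in>A. P (Inl j)) \<and> (\<forall>j\<in>D. P (Inr j))" for P by auto
        ultimately show ?thesis unfolding J by auto
      qed
      also have "prob \<dots> = prob ((\<lambda>\<omega> j. X j \<omega>) -` ?S \<inter> space M) * prob ((\<lambda>\<omega> j. Y j \<omega>) -` ?T \<inter> space M)"
        by (rule indep_varD[OF XY[unfolded indep_sequences_def] meas[OF AB(1) E(1)] meas[OF AB(2) E(1)]])
      also have "prob ((\<lambda>\<omega> j. X j \<omega>) -` ?S \<inter> space M) = (\<Prod>j\<in>A. prob (X j -` E (Inl j) \<inter> space M))"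
        by (rule pre'[OF X AB(1)]) (rule E(1))
      also have "prob ((\<lambda>\<omega> j. Y j \<omega>) -` ?T \<inter> space M) = (\<Prod>j\<in>D. prob (Y j -` E (Inr j) \<inter> space M))"
        by (rule pre'[OF Y AB(2)]) (rule E(1))
      also have "(\<Prod>j\<in>A. prob (X j -` E (Inl j) \<inter> space M)) * (\<Prod>j\<in>D. prob (Y j -` E (Inr j) \<inter> space M))
          = (\<Prod>c\<in>J. prob (case_sum X Y c -` E c \<inter> space M))"
        unfolding J using AB by (simp add: prod.Plus)
      also have "\<dots> = (\<Prod>c\<in>J. prob (F c))" using E(2) by simp
      finally show "prob (\<Inter>c\<in>J. F c) = (\<Prod>c\<in>J. prob (F c))" .
    qed
  qed
qed

lemma unit_exponential_AE_pos:
  assumes "prob_space M" "unit_exponential M V"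
  shows "AE \<omega> in M. V \<omega> > 0"
proof -
  interpret prob_space M by fact
  have D: "distributed M lborel V (exponential_density 1)"
    using assms(2) by (simp add: unit_exponential_def)
  then have [measurable]: "V \<in> borel_measurable M"
    using distributed_measurable by fastforce
  have "\<P>(\<omega> in M. V \<omega> \<le> 0) = 0"
    using exponential_distributedD_le[OF D, of 0] by simp
  then have "AE \<omega> in M. \<not> V \<omega> \<le> 0"
    by (subst (asm) prob_Collect_eq_0) auto
  then show ?thesis by eventually_elim simp
qed

lemma distr_scaled_unit_exponential:
  assumes "prob_space M" "unit_exponential M V" "t > 0"
  shows "distr M borel (\<lambda>\<omega>. t * V \<omega>) = exponential_measure (1 / t)"
proof -
  interpret prob_space M by fact
  have D: "distributed M lborel V (exponential_density 1)"
    using assms(2) by (simp add: unit_exponential_def)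
  then have V: "V \<in> borel_measurable M"
    "\<And>a. a \<ge> 0 \<Longrightarrow> \<P>(\<omega> in M. V \<omega> \<le> a) = 1 - exp (- a)"
    by (simp_all add: exponential_distributed_iff)
  have "distributed M lborel (\<lambda>\<omega>. t * V \<omega>) (exponential_density (1 / t))"
    unfolding exponential_distributed_iff[of "1 / t", OF divide_pos_pos[OF zero_less_one assms(3)]]
  proof (intro conjI allI impI)
    fix a :: real assume "a \<ge> 0"
    moreover have "t * V \<omega> \<le> a \<longleftrightarrow> V \<omega> \<le> a / t" for \<omega> using assms(3) by (simp add: field_simps)
    ultimately show "\<P>(\<omega> in M. t * V \<omega> \<le> a) = 1 - exp (- a * (1 / t))"
      using V(2)[of "a / t"] assms(3) by simp
  qed (use V(1) in simp)
  from distributed_distr_eq_density[OF this]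
  have "distr M lborel (\<lambda>\<omega>. t * V \<omega>) = exponential_measure (1 / t)"
    unfolding exponential_measure_def .
  then show ?thesis by (simp cong: distr_cong)
qed

lemma leads_restrict: "leads J a h (restrict z J) = leads J a h z"
proof -
  have "{d\<in>J. P d \<and> restrict z J d \<le> restrict z J e} = {d\<in>J. P d \<and> z d \<le> z e}" if "e \<in> J" for P e
    using that by auto
  then show ?thesis unfolding leads_def by (simp del: restrict_apply cong: ball_cong)
qed

lemma sets_leads:
  assumes "\<And>j. X j \<in> borel_measurable M" "\<And>j. Y j \<in> borel_measurable M"
  shows "{\<omega> \<in> space M. leads ({..<n} <+> {..<n}) a h (case_sum (\<lambda>j. X j \<omega>) (\<lambda>j. t * Y j \<omega>))} \<in> sets M"
proof -
  let ?J = "{..<n} <+> {..<n} :: (nat + nat) set" and ?Z = "\<lambda>\<omega>. case_sum (\<lambda>j. X j \<omega>) (\<lambda>j. t * Y j \<omega>)"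
  have meas: "(\<lambda>\<omega>. \<lambda>c\<in>?J. ?Z \<omega> c) \<in> measurable M (race_measure q ?J)" for q
  proof (intro measurable_restrict)
    fix c
    have "(\<lambda>\<omega>. ?Z \<omega> c) \<in> borel_measurable M" using assms by (cases c) simp_all
    then show "(\<lambda>\<omega>. ?Z \<omega> c) \<in> measurable M (exponential_measure (side_rate q c))"
      unfolding measurable_cong_sets[OF refl sets_exponential_measure] .
  qed
  have "Measurable.pred M (\<lambda>\<omega>. leads ?J a h (\<lambda>c\<in>?J. ?Z \<omega> c))"
    by (rule measurable_compose[OF meas pred_leads]) simp
  then show ?thesis unfolding pred_def leads_restrict .
qed

text \<open>
For finite \<open>n\<close> the probability is exact. The clocks \<open>X j\<close> and \<open>t * Y j\<close> are independent exponential variables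
of rates \<open>1\<close> and \<open>1 / t\<close>, so their joint law is the product measure in which the race was computed.
Starting with \<open>h = 1\<close> means starting with a tie.
\<close>

lemma prob_leads_eq_race:
  assumes "prob_space M" and X: "iid_unit_exponential M X" and Y: "iid_unit_exponential M Y"
    and XY: "indep_sequences M X Y" and t: "t > 0" and l: "1 \<le> l" "l \<le> n"
  shows "measure M {\<omega> \<in> space M. leads ({..<n} <+> {..<n}) l 1 (case_sum (\<lambda>j. X j \<omega>) (\<lambda>j. t * Y j \<omega>))}
    = race (1 / t) l 1 n n"
proof -
  interpret prob_space M by fact
  have indX: "indep_vars (\<lambda>_. borel) X UNIV" and indY: "indep_vars (\<lambda>_. borel) Y UNIV"
    and unitX: "\<And>j. unit_exponential M (X j)" and unitY: "\<And>j. unit_exponential M (Y j)"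
    using X Y by (auto simp: iid_unit_exponential_def)
  define J :: "(nat + nat) set" where "J = {..<n} <+> {..<n}"
  have J: "finite J" "J \<noteq> {}" using l by (auto simp: J_def lessThan_empty_iff bot_nat_def)
  have cards: "card {c\<in>J. isl c} = n" "card {c\<in>J. \<not> isl c} = n"
    using card_Plus_filter[of "{..<n}" "{..<n}" "\<lambda>_. 0" 0] by (simp_all add: J_def)
  define Z where "Z = case_sum X (\<lambda>j \<omega>. t * Y j \<omega>)"
  have Zeq: "(\<lambda>c. Z c \<omega>) = case_sum (\<lambda>j. X j \<omega>) (\<lambda>j. t * Y j \<omega>)" for \<omega>
    by (auto simp: Z_def split: sum.split)
  have "indep_vars (\<lambda>_. borel) (case_sum X Y) UNIV"
    by (rule indep_vars_case_sum[OF \<open>prob_space M\<close> indX indY XY])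
  then have "indep_vars (\<lambda>_. borel) (\<lambda>c \<omega>. case_sum (\<lambda>_ x. x) (\<lambda>_ x. t * x) c (case_sum X Y c \<omega>)) UNIV"
    by (rule indep_vars_compose2) (auto split: sum.split)
  also have "(\<lambda>c \<omega>. case_sum (\<lambda>_ x. x) (\<lambda>_ x. t * x) c (case_sum X Y c \<omega>)) = Z"
    by (auto simp: Z_def fun_eq_iff split: sum.split)
  finally have ind: "indep_vars (\<lambda>_. borel) Z UNIV" .
  then have Zmeas: "Z c \<in> borel_measurable M" for c by (auto simp: indep_vars_def)
  have "distr M (\<Pi>\<^sub>M c\<in>J. borel) (\<lambda>\<omega>. \<lambda>c\<in>J. Z c \<omega>) = (\<Pi>\<^sub>M c\<in>J. distr M borel (Z c))"
    using indep_vars_subset[OF ind, of J] indep_vars_iff_distr_eq_PiM[OF J(2), where M' = "\<lambda>_. borel" and X = Z] Zmeas by simp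
  also have "\<dots> = race_measure (1 / t) J"
  proof (rule PiM_cong[OF refl])
    fix c show "distr M borel (Z c) = exponential_measure (side_rate (1 / t) c)"
      using distr_scaled_unit_exponential[OF \<open>prob_space M\<close> unitX, of 1]
        distr_scaled_unit_exponential[OF \<open>prob_space M\<close> unitY t]
      by (cases c) (simp_all add: Z_def side_rate_def)
  qed
  finally have law: "distr M (\<Pi>\<^sub>M c\<in>J. borel) (\<lambda>\<omega>. \<lambda>c\<in>J. Z c \<omega>) = race_measure (1 / t) J" .
  have meas: "(\<lambda>\<omega>. \<lambda>c\<in>J. Z c \<omega>) \<in> measurable M (\<Pi>\<^sub>M c\<in>J. borel)"
    by (intro measurable_restrict Zmeas)
  \<comment> \<open>positivity holds almost surely; it is the lower bound 0 on all clocks under which the race was computed\<close>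
  let ?E = "{z \<in> space (race_measure (1 / t) J). (\<forall>c\<in>J. 0 < z c) \<and> leads J l 1 z}"
  have sp: "space (race_measure (1 / t) J) = space (\<Pi>\<^sub>M c\<in>J. borel)"
    and se: "sets (race_measure (1 / t) J) = sets (\<Pi>\<^sub>M c\<in>J. borel)"
    unfolding law[symmetric] by simp_all
  have E: "?E \<in> sets (race_measure (1 / t) J)"
  proof -
    have "{z \<in> space (race_measure (1 / t) J). \<forall>c\<in>J. 0 < z c} \<inter> {z \<in> space (race_measure (1 / t) J). leads J l 1 z}
        \<in> sets (race_measure (1 / t) J)"
      using pred_leads[OF J(1), where q = "1 / t" and a = l and h = 1] t
      by (intro sets.Int sets_PiM_exponential_greaterThan side_rate_pos J(1)) (simp_all add: pred_def)
    also have "{z \<in> space (race_measure (1 / t) J). \<forall>c\<in>J. 0 < z c} \<inter> {z \<in> space (race_measure (1 / t) J). leads J l 1 z} = ?E"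
      by blast
    finally show ?thesis .
  qed
  have pos: "AE \<omega> in M. \<forall>c\<in>J. 0 < Z c \<omega>"
  proof (rule AE_finite_allI[OF J(1)])
    fix c
    have "AE \<omega> in M. X j \<omega> > 0" "AE \<omega> in M. Y j \<omega> > 0" for j
      by (rule unit_exponential_AE_pos[OF \<open>prob_space M\<close> unitX], rule unit_exponential_AE_pos[OF \<open>prob_space M\<close> unitY])
    then show "AE \<omega> in M. 0 < Z c \<omega>" using t by (cases c) (simp_all add: Z_def zero_less_mult_iff)
  qed
  have vim: "(\<lambda>\<omega>. \<lambda>c\<in>J. Z c \<omega>) -` ?E \<inter> space M = {\<omega> \<in> space M. (\<forall>c\<in>J. 0 < Z c \<omega>) \<and> leads J l 1 (\<lambda>c. Z c \<omega>)}"
    using measurable_space[OF meas] unfolding sp by (auto simp: leads_restrict)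
  have "emeasure M {\<omega> \<in> space M. leads J l 1 (\<lambda>c. Z c \<omega>)}
      = emeasure M ((\<lambda>\<omega>. \<lambda>c\<in>J. Z c \<omega>) -` ?E \<inter> space M)"
  proof (rule emeasure_eq_AE)
    show "AE \<omega> in M. \<omega> \<in> {\<omega> \<in> space M. leads J l 1 (\<lambda>c. Z c \<omega>)} \<longleftrightarrow> \<omega> \<in> (\<lambda>\<omega>. \<lambda>c\<in>J. Z c \<omega>) -` ?E \<inter> space M"
      unfolding vim using pos by eventually_elim simp
    show "(\<lambda>\<omega>. \<lambda>c\<in>J. Z c \<omega>) -` ?E \<inter> space M \<in> sets M"
      using E unfolding se by (rule measurable_sets[OF meas])
    show "{\<omega> \<in> space M. leads J l 1 (\<lambda>c. Z c \<omega>)} \<in> sets M"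
      unfolding Zeq J_def
      by (rule sets_leads) (use indX indY in \<open>auto simp: indep_vars_def\<close>)
  qed
  also have "\<dots> = emeasure (race_measure (1 / t) J) ?E"
    unfolding law[symmetric] using E meas unfolding se by (subst emeasure_distr) (simp_all add: law sp)
  also have "\<dots> = ennreal (race (1 / t) l 1 n n)"
    using emeasure_race_leads[of "1 / t" J 0 l 1] J(1) t l(2) unfolding cards by simp
  finally show ?thesis
    using t race_nonneg[of "1 / t" l 1 n n] unfolding Zeq J_def[symmetric] by (simp add: measure_def)
qed

section \<open>The limit law\<close>

lemma isCont_ballot: "isCont (\<lambda>p. ballot p a h) x"
proof (induction x a h rule: ballot.induct)
  case (3 x a h)
  then show ?case by (simp add: continuous_intros)
qed simp_all

lemma ballot_0: "a > 0 \<Longrightarrow> ballot 0 a h = 0"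
  by (cases a) (simp_all add: ballot_closed_form)

lemma ballot_1: "h > 0 \<Longrightarrow> ballot 1 a h = 1"
proof (induction a arbitrary: h)
  case (Suc a)
  then show ?case by (cases h) simp_all
qed simp

theorem theorem2p4:
  fixes M :: "'a measure" and X Y :: "nat \<Rightarrow> 'a \<Rightarrow> real" and l :: nat
  assumes "prob_space M"
    and "iid_unit_exponential M X"
    and "iid_unit_exponential M Y"
    and "indep_sequences M X Y"
    and "l \<ge> 1"
  shows "\<exists>\<mu>. real_distribution \<mu>
    \<and> weak_conv_m (\<lambda>n. distr M borel (max_ratio X Y l n)) \<mu>
    \<and> nondegenerate \<mu>
    \<and> (\<forall>t\<ge>0. cdf \<mu> t = R l t
        \<and> (\<lambda>n. measure M {\<omega> \<in> space M. max_ratio X Y l n \<omega> \<le> t}) \<longlonglongrightarrow> R l t)"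
proof -
  interpret prob_space M by fact
  let ?P = "\<lambda>n t. measure M {\<omega> \<in> space M. max_ratio X Y l n \<omega> \<le> t}"
  have unit: "unit_exponential M (X j)" "unit_exponential M (Y j)" for j
    using assms(2,3) by (auto simp: iid_unit_exponential_def)
  have borel: "X j \<in> borel_measurable M" "Y j \<in> borel_measurable M" for j
    using unit[of j] by (auto simp: unit_exponential_def dest: distributed_real_measurable distributed_measurable)
  have pos: "AE \<omega> in M. (\<forall>j. X j \<omega> > 0) \<and> (\<forall>j. Y j \<omega> > 0)"
    using unit_exponential_AE_pos[OF assms(1) unit(1)] unit_exponential_AE_pos[OF assms(1) unit(2)]
    by (simp add: AE_all_countable)
  have max_borel: "max_ratio X Y l n \<in> borel_measurable M" if "l \<le> n" for n
    by (rule borel_measurable_max_ratio[OF borel that])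

  \<comment> \<open>the clamped argument makes F a continuous distribution function on the whole line\<close>
  define F where "F t = ballot (max 0 t / (1 + max 0 t)) l 1" for t :: real
  have F_R: "F t = R l t" if "t \<ge> 0" for t
    using that assms(5) ballot_eq_R[of l t] ballot_0[of l 1] by (cases "t = 0") (auto simp: F_def R_def)
  have lim: "(\<lambda>n. ?P n t) \<longlonglongrightarrow> F t" for t
  proof (cases "t > 0")
    case True
    have ev: "\<forall>\<^sub>F n in sequentially. race (1 / t) l 1 (n - 0) (n - 0) = ?P n t"
      using eventually_ge_at_top[of l]
    proof eventually_elim
      case (elim n)
      let ?E = "{\<omega> \<in> space M. leads ({..<n} <+> {..<n}) l 1 (case_sum (\<lambda>j. X j \<omega>) (\<lambda>j. t * Y j \<omega>))}"
      have "AE \<omega> in M. \<omega> \<in> {\<omega> \<in> space M. max_ratio X Y l n \<omega> \<le> t} \<longleftrightarrow> \<omega> \<in> ?E"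
        using pos
      proof eventually_elim
        case (elim \<omega>)
        then show ?case using max_ratio_le_iff_leads[of Y \<omega> t l n X] \<open>t > 0\<close> \<open>l \<le> n\<close> assms(5) by simp
      qed
      moreover have "{\<omega> \<in> space M. max_ratio X Y l n \<omega> \<le> t} \<in> sets M"
        using max_borel[OF elim] unfolding borel_measurable_iff_le by blast
      moreover have "?E \<in> sets M"
        by (rule sets_leads[OF borel])
      ultimately have "?P n t = measure M ?E" by (rule measure_eq_AE)
      then show ?case using prob_leads_eq_race[OF assms(1-4) True assms(5) elim] by simp
    qed
    have "(\<lambda>n. race (1 / t) l 1 (n - 0) (n - 0)) \<longlonglongrightarrow> ballot (1 / (1 + 1 / t)) l 1"
      using True by (intro race_tendsto_ballot) simp
    moreover have "1 / (1 + 1 / t) = max 0 t / (1 + max 0 t)" using True by (simp add: field_simps)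
    ultimately have "(\<lambda>n. race (1 / t) l 1 (n - 0) (n - 0)) \<longlonglongrightarrow> F t"
      unfolding F_def by simp
    from this ev show ?thesis by (rule Lim_transform_eventually)
  next
    case False
    have F0: "F t = 0" unfolding F_def using False assms(5) by (simp add: max_absorb1 ballot_0)
    have "\<forall>\<^sub>F n in sequentially. ?P n t = F t"
      using eventually_ge_at_top[of l]
    proof eventually_elim
      case (elim n)
      have "AE \<omega> in M. \<not> max_ratio X Y l n \<omega> \<le> t"
        using pos
      proof eventually_elim
        case (elim \<omega>)
        then have "max_ratio X Y l n \<omega> > 0" using \<open>l \<le> n\<close> assms(5) by (intro max_ratio_pos) auto
        then show ?case using False by simp
      qed
      moreover have "{\<omega> \<in> space M. max_ratio X Y l n \<omega> \<le> t} \<in> sets M"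
        using max_borel[OF elim] unfolding borel_measurable_iff_le by blast
      ultimately show ?case unfolding F0 by (subst prob_Collect_eq_0) auto
    qed
    then show ?thesis by (rule tendsto_eventually)
  qed

  \<comment> \<open>monotonicity is inherited from the prelimit distribution functions\<close>
  have F_mono: "F s \<le> F t" if "s \<le> t" for s t
  proof (rule tendsto_le[OF _ lim lim])
    show "\<forall>\<^sub>F n in sequentially. ?P n s \<le> ?P n t"
      using eventually_ge_at_top[of l]
    proof eventually_elim
      case (elim n)
      have "{\<omega> \<in> space M. max_ratio X Y l n \<omega> \<le> t} \<in> sets M"
        using max_borel[OF elim] unfolding borel_measurable_iff_le by blast
      then show ?case using that by (intro finite_measure_mono) auto
    qed
  qed simp
  have F_cont: "isCont F t" for t
  proof -
    have "isCont (\<lambda>t. max 0 t / (1 + max 0 t)) t" for t :: real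
      by (intro continuous_intros) (simp add: max_def)
    from isCont_o2[OF this isCont_ballot[where a = l and h = 1]] show ?thesis unfolding F_def[abs_def] .
  qed
  have F_right: "continuous (at_right t) F" for t
    using F_cont by (rule continuous_at_imp_continuous_at_within)
  have F_bot: "(F \<longlongrightarrow> 0) at_bot"
  proof (rule tendsto_eventually)
    show "\<forall>\<^sub>F t in at_bot. F t = 0"
      using eventually_le_at_bot[of 0] by eventually_elim (use assms(5) in \<open>simp add: F_def max_absorb1 ballot_0\<close>)
  qed
  have F_top: "(F \<longlongrightarrow> 1) at_top"
  proof -
    have "((\<lambda>t::real. max 0 t / (1 + max 0 t)) \<longlongrightarrow> 1) at_top"
      by real_asymp
    from isCont_tendsto_compose[OF isCont_ballot[where a = l and h = 1] this] show ?thesis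
      unfolding F_def[abs_def] by (simp add: ballot_1)
  qed

  define \<mu> where "\<mu> = interval_measure F"
  have \<mu>: "real_distribution \<mu>"
    unfolding \<mu>_def by (rule real_distribution_interval_measure[OF F_mono F_right F_bot F_top])
  have cdf_\<mu>: "cdf \<mu> = F"
    unfolding \<mu>_def by (rule cdf_interval_measure[OF F_mono F_right F_bot])
  interpret \<mu>: real_distribution \<mu> by fact
  have "nondegenerate \<mu>"
    unfolding nondegenerate_def
  proof
    assume "\<exists>c. AE x in \<mu>. x = c"
    then obtain c where "AE x in \<mu>. x \<in> {c}" by auto
    \<comment> \<open>a constant would be an atom of mass 1, but the distribution function is continuous\<close>
    then have "measure \<mu> {c} = 1" by (subst (asm) \<mu>.prob_eq_1[symmetric]) auto
    moreover have "measure \<mu> {c} = 0" using F_cont \<mu>.isCont_cdf[of c] unfolding cdf_\<mu> by simp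
    ultimately show False by simp
  qed
  moreover have "weak_conv_m (\<lambda>n. distr M borel (max_ratio X Y l n)) \<mu>"
    unfolding weak_conv_m_def weak_conv_def cdf_\<mu>
  proof (intro allI impI)
    fix t
    have "\<forall>\<^sub>F n in sequentially. ?P n t = cdf (distr M borel (max_ratio X Y l n)) t"
      using eventually_ge_at_top[of l]
      by eventually_elim
        (use max_borel in \<open>auto simp: cdf_def measure_distr intro!: arg_cong[where f = "measure M"]\<close>)
    with lim show "(\<lambda>n. cdf (distr M borel (max_ratio X Y l n)) t) \<longlonglongrightarrow> F t"
      by (rule Lim_transform_eventually)
  qed
  moreover have "cdf \<mu> t = R l t \<and> (\<lambda>n. ?P n t) \<longlonglongrightarrow> R l t" if "t \<ge> 0" for t
    using lim[of t] F_R[OF that] by (simp add: cdf_\<mu>)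
  ultimately show ?thesis using \<mu> by blast
qed

end
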